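(* Let $\theta>0$ and, for $\beta\ge0$, let $$\mathcal{F}_\beta:=\Bigl\{f\colon\mathbb{N}\to(0,\infty)\ \text{such that}\ \Delta\log f(n)\ge-\beta\ \text{for all } n\ge1\ \text{and}\ \int f\,d\pi_\theta=1\Bigr\}.$$ Then for all $\beta>0$, $$\limsup_{t\to\infty}\ t\sup_{f\in\mathcal{F}_\beta}\pi_\theta(\{n:f(n)\ge t\})>0.$$
   Context: $\mathbb{N}=\{0,1,2,\dots\}$. For $g\colon\mathbb{N}\to\mathbb{R}$ and $n\ge1$, $\Delta g(n):=g(n+1)+g(n-1)-2g(n)$. $\pi_\theta$ is the Poisson probability measure on $\mathbb{N}$: $\pi_\theta(k)=e^{-\theta}\theta^k/k!$. *)

theory Defs
  imports "HOL-Probability.Probability"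
begin

text \<open>The discrete Laplacian. It is only meaningful for \<open>n \<ge> 1\<close>, since \<open>n - 1\<close> is truncated on \<^typ>\<open>nat\<close>.\<close>

definition discrete_laplacian :: "(nat \<Rightarrow> real) \<Rightarrow> nat \<Rightarrow> real" where
  "discrete_laplacian g n = g (n + 1) + g (n - 1) - 2 * g n"

text \<open>The integral is the Bochner integral, which is \<open>0\<close> for functions that are not integrable;
  hence the condition that it equals \<open>1\<close> includes integrability of \<open>f\<close>.\<close>

definition semi_log_convex_densities :: "real \<Rightarrow> real \<Rightarrow> (nat \<Rightarrow> real) set" where
  "semi_log_convex_densities \<theta> \<beta> =
     {f. (\<forall>n. f n > 0) \<and>
         (\<forall>n\<ge>1. discrete_laplacian (\<lambda>k. ln (f k)) n \<ge> - \<beta>) \<and>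
         (\<integral>n. f n \<partial>measure_pmf (poisson_pmf \<theta>)) = 1}"

end

theory Submission
  imports Defs
begin

text \<open>
  Exponential tilting moves the mode of the Poisson weights to any given \<open>N \<ge> 1\<close>: the weights
  \<open>\<pi>\<^sub>\<theta>(n) (N/\<theta>)^(n - N)\<close> are proportional to \<open>N^n/n!\<close>, which is maximal at \<open>n = N\<close>.
  Multiplying the tilt by the Gaussian factor \<open>exp (- \<beta> (n - N)\<^sup>2 / 2)\<close> gives a function \<open>g\<^sub>N\<close>
  with \<open>\<Delta> log g\<^sub>N = - \<beta>\<close>, \<open>g\<^sub>N(N) = 1\<close> and \<open>g\<^sub>N(n) \<pi>\<^sub>\<theta>(n) \<le> \<pi>\<^sub>\<theta>(N) r^\<bar>n - N\<bar>\<close> where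
  \<open>r = exp (- \<beta> / 2) < 1\<close>. Hence \<open>Z\<^sub>N = \<integral> g\<^sub>N d\<pi>\<^sub>\<theta> \<le> 2 \<pi>\<^sub>\<theta>(N) / (1 - r)\<close>: the single point \<open>N\<close>
  carries a fraction at least \<open>(1 - r) / 2\<close> of the total mass, uniformly in \<open>N\<close>.

  The density \<open>f\<^sub>N = g\<^sub>N / Z\<^sub>N\<close> belongs to the class, and at the level \<open>t\<^sub>N = f\<^sub>N(N) = 1 / Z\<^sub>N\<close> it
  satisfies \<open>t\<^sub>N \<pi>\<^sub>\<theta>(f\<^sub>N \<ge> t\<^sub>N) \<ge> f\<^sub>N(N) \<pi>\<^sub>\<theta>(N) \<ge> (1 - r) / 2\<close>. As \<open>\<pi>\<^sub>\<theta>(N) \<rightarrow> 0\<close>, also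
  \<open>Z\<^sub>N \<rightarrow> 0\<close>, so the levels \<open>t\<^sub>N\<close> are unbounded and the limit superior is at least \<open>(1 - r) / 2\<close>.
\<close>

text \<open>The ratio of the weights at \<open>n + 1\<close> and \<open>n\<close> is \<open>N / (n + 1)\<close>, so they increase up to \<open>N\<close> and
  decrease from there.\<close>

lemma poisson_weight_le_at_mean:
  fixes N n :: nat
  shows "real N ^ n / fact n \<le> real N ^ N / fact N"
proof (cases "n \<le> N")
  case True
  then show ?thesis
  proof (induction n rule: inc_induct)
    case base
    show ?case by simp
  next
    case (step n)
    have "real N ^ n / fact n = real N ^ n * real (Suc n) / fact (Suc n)"
      by (simp only: fact_Suc) (simp del: of_nat_Suc)
    also have "\<dots> \<le> real N ^ n * real N / fact (Suc n)"
      using step.hyps by (intro divide_right_mono mult_left_mono) auto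
    also have "\<dots> = real N ^ Suc n / fact (Suc n)"
      by (simp add: mult.commute)
    finally show ?case using step.IH by linarith
  qed
next
  case False
  then have "N \<le> n" by simp
  then show ?thesis
  proof (induction n rule: dec_induct)
    case base
    show ?case by simp
  next
    case (step n)
    have "real N ^ Suc n / fact (Suc n) = real N ^ n * real N / fact (Suc n)"
      by (simp add: mult.commute)
    also have "\<dots> \<le> real N ^ n * real (Suc n) / fact (Suc n)"
      using step.hyps by (intro divide_right_mono mult_left_mono) auto
    also have "\<dots> = real N ^ n / fact n"
      by (simp only: fact_Suc) (simp del: of_nat_Suc)
    finally show ?case using step.IH by linarith
  qed
qed

lemma two_sided_geometric_sum:
  fixes r :: real and N :: nat
  assumes "0 \<le> r" and "r < 1"
  shows "summable (\<lambda>n. r ^ nat \<bar>int n - int N\<bar>)"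
    and "(\<Sum>n. r ^ nat \<bar>int n - int N\<bar>) \<le> 2 / (1 - r)"
proof -
  let ?h = "\<lambda>n. r ^ nat \<bar>int n - int N\<bar>"
  have geo: "(\<lambda>n. r ^ n) sums (1 / (1 - r))"
    using assms by (intro geometric_sums) auto
  have "(\<lambda>n. ?h (n + N)) sums (1 / (1 - r))"
    using geo by simp
  then have sums: "?h sums (1 / (1 - r) + (\<Sum>i<N. ?h i))"
    by (rule sums_iff_shift [THEN iffD1])
  then show "summable ?h" by (rule sums_summable)
  have "(\<Sum>i<N. ?h i) \<le> (\<Sum>i<N. r ^ (N - Suc i))"
    using assms by (intro sum_mono power_decreasing) auto
  also have "\<dots> = (\<Sum>i<N. r ^ i)"
    by (rule sum.nat_diff_reindex)
  also have "\<dots> \<le> (\<Sum>i. r ^ i)"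
    using assms geo by (intro sum_le_suminf) (auto simp: sums_iff)
  also have "\<dots> = 1 / (1 - r)"
    using geo by (simp add: sums_iff)
  finally show "suminf ?h \<le> 2 / (1 - r)"
    using sums by (simp add: sums_iff)
qed

lemma integral_pmf_nat_eq_suminf:
  fixes p :: "nat pmf" and f :: "nat \<Rightarrow> real"
  assumes "summable (\<lambda>n. pmf p n * \<bar>f n\<bar>)"
  shows "(\<integral>n. f n \<partial>measure_pmf p) = (\<Sum>n. pmf p n * f n)"
proof -
  have "(\<integral>n. f n \<partial>measure_pmf p) = (\<integral>n. pmf p n * f n \<partial>count_space UNIV)"
    by (simp add: measure_pmf_eq_density integral_density)
  also have "\<dots> = (\<Sum>n. pmf p n * f n)"
    using assms by (intro integral_count_space_nat)
      (simp add: integrable_count_space_nat_iff abs_mult)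
  finally show ?thesis .
qed

text \<open>The unnormalised density: the tilt \<open>(N/\<theta>)^(n - N)\<close>, written as an exponential because the
  exponent may be negative, times a Gaussian factor centred at \<open>N\<close>.\<close>

definition tilted_gaussian :: "real \<Rightarrow> real \<Rightarrow> nat \<Rightarrow> nat \<Rightarrow> real" where
  "tilted_gaussian \<theta> \<beta> N n =
     exp ((real n - real N) * ln (real N / \<theta>) - \<beta> / 2 * (real n - real N)\<^sup>2)"

lemma tilted_gaussian_pos: "tilted_gaussian \<theta> \<beta> N n > 0"
  by (simp add: tilted_gaussian_def)

lemma tilted_gaussian_centre: "tilted_gaussian \<theta> \<beta> N N = 1"
  by (simp add: tilted_gaussian_def)

lemma discrete_laplacian_ln_tilted_gaussian:
  assumes "n \<ge> 1"
  shows "discrete_laplacian (\<lambda>k. ln (tilted_gaussian \<theta> \<beta> N k)) n = - \<beta>"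
  using assms
  by (simp add: discrete_laplacian_def tilted_gaussian_def of_nat_diff power2_eq_square
      field_simps)

lemma pmf_poisson_tilted_gaussian_le:
  assumes "\<theta> > 0" and "\<beta> \<ge> 0" and "N \<ge> 1"
  shows "pmf (poisson_pmf \<theta>) n * tilted_gaussian \<theta> \<beta> N n
    \<le> pmf (poisson_pmf \<theta>) N * exp (- \<beta> / 2) ^ nat \<bar>int n - int N\<bar>"
proof -
  define d where "d = nat \<bar>int n - int N\<bar>"
  have sq: "(real n - real N)\<^sup>2 = real d * real d"
    unfolding d_def by (simp add: power2_eq_square abs_if algebra_simps of_nat_diff)
  \<comment> \<open>Since \<open>d \<le> d\<^sup>2\<close> for integers, the Gaussian is dominated by a geometric sequence.\<close>
  have "real d \<le> (real n - real N)\<^sup>2"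
    unfolding sq by (cases d) auto
  then have gauss: "exp (- (\<beta> / 2 * (real n - real N)\<^sup>2)) \<le> exp (- \<beta> / 2) ^ d"
    using assms by (simp add: exp_of_nat_mult [symmetric] mult_left_mono mult.commute)
  have "exp ((real n - real N) * ln (real N / \<theta>)) = (real N / \<theta>) ^ n / (real N / \<theta>) ^ N"
    using assms by (simp add: left_diff_distrib exp_diff exp_of_nat_mult)
  then have tilt: "\<theta> ^ n / fact n * exp ((real n - real N) * ln (real N / \<theta>))
      = (real N ^ n / fact n) * (\<theta> ^ N / real N ^ N)"
    using assms by (simp add: power_divide field_simps)
  also have "\<dots> \<le> (real N ^ N / fact N) * (\<theta> ^ N / real N ^ N)"
    using assms by (intro mult_right_mono poisson_weight_le_at_mean) auto
  also have "\<dots> = \<theta> ^ N / fact N"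
    using assms by simp
  finally have mode: "\<theta> ^ n / fact n * exp ((real n - real N) * ln (real N / \<theta>))
      \<le> \<theta> ^ N / fact N" .
  have "pmf (poisson_pmf \<theta>) n * tilted_gaussian \<theta> \<beta> N n
      = exp (- \<theta>) * ((\<theta> ^ n / fact n * exp ((real n - real N) * ln (real N / \<theta>)))
          * exp (- (\<beta> / 2 * (real n - real N)\<^sup>2)))"
    using assms by (simp add: tilted_gaussian_def diff_conv_add_uminus exp_add del: add_uminus_conv_diff)
  also have "\<dots> \<le> exp (- \<theta>) * (\<theta> ^ N / fact N * exp (- \<beta> / 2) ^ d)"
    using assms by (intro mult_left_mono mult_mono mode gauss) auto
  also have "\<dots> = pmf (poisson_pmf \<theta>) N * exp (- \<beta> / 2) ^ d"
    using assms by simp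
  finally show ?thesis unfolding d_def .
qed

lemma pmf_nat_tendsto_zero:
  fixes p :: "nat pmf"
  shows "pmf p \<longlonglongrightarrow> 0"
proof -
  have "integrable (count_space UNIV) (pmf p)"
    using pmf_abs_summable [of p UNIV] by (simp add: abs_summable_on_def)
  then have "summable (pmf p)"
    by (simp add: integrable_count_space_nat_iff)
  then show ?thesis by (rule summable_LIMSEQ_zero)
qed

text \<open>The density is \<open>tilted_gaussian \<theta> \<beta> N\<close> divided by its integral. The lower bound on its mass
  at \<open>N\<close> does not depend on \<open>N\<close> or \<open>\<theta>\<close>.\<close>

lemma density_with_mass_at_point:
  assumes "\<theta> > 0" and "\<beta> > 0" and "N \<ge> 1"
  shows "\<exists>f\<in>semi_log_convex_densities \<theta> \<beta>.
    f N * pmf (poisson_pmf \<theta>) N \<ge> (1 - exp (- \<beta> / 2)) / 2"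
proof -
  let ?\<pi> = "pmf (poisson_pmf \<theta>)"
  define g where "g = tilted_gaussian \<theta> \<beta> N"
  define r where "r = exp (- \<beta> / 2)"
  define Z where "Z = (\<Sum>n. ?\<pi> n * g n)"
  let ?h = "\<lambda>n. r ^ nat \<bar>int n - int N\<bar>"
  have r: "0 < r" "r < 1" using assms by (auto simp: r_def)
  note h = two_sided_geometric_sum [of r N, OF less_imp_le [OF r(1)] r(2)]
  have g_pos: "g n > 0" for n by (simp add: g_def tilted_gaussian_pos)
  have g_N: "g N = 1" by (simp add: g_def tilted_gaussian_centre)
  have \<pi>_pos: "?\<pi> n > 0" for n using assms by simp
  have le: "?\<pi> n * g n \<le> ?\<pi> N * ?h n" for n
    using pmf_poisson_tilted_gaussian_le [of \<theta> \<beta> N n] assms by (simp only: g_def r_def less_imp_le)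
  have summ_h: "summable (\<lambda>n. ?\<pi> N * ?h n)"
    using h(1) by (rule summable_mult)
  have summ: "summable (\<lambda>n. ?\<pi> n * g n)"
  proof (rule summable_comparison_test' [OF summ_h])
    show "norm (?\<pi> n * g n) \<le> ?\<pi> N * ?h n" for n
      using le [of n] g_pos [of n] by (simp only: real_norm_def abs_mult
          pmf_nonneg abs_of_nonneg less_imp_le)
  qed
  have Z_pos: "Z > 0"
    unfolding Z_def using summ by (rule suminf_pos) (intro mult_pos_pos g_pos \<pi>_pos)
  have "Z \<le> (\<Sum>n. ?\<pi> N * ?h n)"
    unfolding Z_def by (intro suminf_le le summ summ_h)
  also have "\<dots> = ?\<pi> N * (\<Sum>n. ?h n)"
    using h(1) by (rule suminf_mult)
  also have "\<dots> \<le> ?\<pi> N * (2 / (1 - r))"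
    by (intro mult_left_mono h(2)) auto
  finally have Z_le: "Z \<le> ?\<pi> N * (2 / (1 - r))" .
  define f where "f = (\<lambda>n. g n / Z)"
  have "(\<integral>n. g n \<partial>measure_pmf (poisson_pmf \<theta>)) = Z"
    unfolding Z_def by (intro integral_pmf_nat_eq_suminf) (use summ in \<open>simp only: abs_of_pos g_pos\<close>)
  then have int: "(\<integral>n. f n \<partial>measure_pmf (poisson_pmf \<theta>)) = 1"
    using Z_pos by (simp add: f_def)
  have "discrete_laplacian (\<lambda>k. ln (f k)) n = discrete_laplacian (\<lambda>k. ln (g k)) n" for n
    using Z_pos g_pos by (simp add: discrete_laplacian_def f_def ln_div less_imp_neq [symmetric])
  then have "discrete_laplacian (\<lambda>k. ln (f k)) n = - \<beta>" if "n \<ge> 1" for n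
    using that discrete_laplacian_ln_tilted_gaussian by (simp add: g_def)
  then have "f \<in> semi_log_convex_densities \<theta> \<beta>"
    using int Z_pos g_pos by (auto simp: semi_log_convex_densities_def f_def)
  moreover have "(1 - r) / 2 \<le> ?\<pi> N / Z"
    using Z_le Z_pos r(2) by (simp only: field_simps) (simp add: field_simps)
  then have "f N * ?\<pi> N \<ge> (1 - r) / 2"
    by (simp only: f_def g_N) simp
  ultimately show ?thesis unfolding r_def by blast
qed

theorem proposition3p10:
  fixes \<theta> \<beta> :: real
  assumes "\<theta> > 0" and "\<beta> > 0"
  shows "Limsup at_top (\<lambda>t::real. ereal t *
           (SUP f\<in>semi_log_convex_densities \<theta> \<beta>.
              ereal (measure_pmf.prob (poisson_pmf \<theta>) {n. f n \<ge> t}))) > 0"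
    (is "Limsup at_top ?F > 0")
proof -
  let ?p = "poisson_pmf \<theta>"
  define c where "c = (1 - exp (- \<beta> / 2)) / 2"
  have c: "c > 0" using assms by (simp add: c_def)
  \<comment> \<open>Arbitrarily large levels \<open>t = f N\<close> are reached by choosing \<open>N\<close> with small Poisson mass.\<close>
  have large: "\<exists>t\<ge>T. ?F t \<ge> ereal c" for T
  proof -
    have "eventually (\<lambda>N. pmf ?p N < c / max T 1) sequentially"
      using pmf_nat_tendsto_zero by (rule order_tendstoD) (use c in auto)
    then have "eventually (\<lambda>N. N \<ge> 1 \<and> pmf ?p N < c / max T 1) sequentially"
      using eventually_ge_at_top [of 1] by eventually_elim simp
    then obtain N where N: "N \<ge> 1" "pmf ?p N < c / max T 1"
      by (auto simp: eventually_sequentially)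
    obtain f where f: "f \<in> semi_log_convex_densities \<theta> \<beta>" and fN: "f N * pmf ?p N \<ge> c"
      using density_with_mass_at_point [OF assms N(1)] unfolding c_def by blast
    have f_pos: "f N > 0" using f by (simp add: semi_log_convex_densities_def)
    have "f N * (c / max T 1) \<ge> c"
      using fN mult_left_mono [OF less_imp_le [OF N(2)] less_imp_le [OF f_pos]] by linarith
    then have "max T 1 \<le> f N"
      using c by (simp add: field_simps)
    then have "T \<le> f N" by simp
    moreover have "?F (f N) \<ge> ereal c"
    proof -
      have "pmf ?p N \<le> measure_pmf.prob ?p {n. f n \<ge> f N}"
        unfolding measure_pmf_single [symmetric]
        by (intro measure_pmf.finite_measure_mono) auto
      then have "c \<le> f N * measure_pmf.prob ?p {n. f n \<ge> f N}"
        using fN f_pos by (meson mult_left_mono less_imp_le order_trans)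
      then have "ereal c \<le> ereal (f N) * ereal (measure_pmf.prob ?p {n. f n \<ge> f N})"
        by simp
      also have "\<dots> \<le> ?F (f N)"
        using f f_pos by (intro ereal_mult_left_mono SUP_upper) auto
      finally show ?thesis .
    qed
    ultimately show ?thesis by blast
  qed
  have "Limsup at_top ?F \<ge> ereal c"
  proof (rule ccontr)
    assume "\<not> Limsup at_top ?F \<ge> ereal c"
    then have "eventually (\<lambda>t. ?F t < ereal c) at_top"
      by (intro Limsup_lessD) simp
    then obtain T where "\<And>t. t \<ge> T \<Longrightarrow> ?F t < ereal c"
      unfolding eventually_at_top_linorder by blast
    with large [of T] show False by (meson not_less)
  qed
  then show ?thesis using c by (meson ereal_less(2) less_le_trans)
qed

end
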